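(* The family of pseudo $n$-state polynomials $\{Z_{\widetilde{W}_n}\}_{n=1}^{\infty}$ is a complete invariant for graphs; that is, for any two finite undirected graphs $G$ and $H$, one has $Z_{\widetilde{W}_n}(G)=Z_{\widetilde{W}_n}(H)$ (as polynomials in the single variable $x$) for all integers $n\ge 1$ if and only if $G$ and $H$ are isomorphic.
   Context: Graphs are finite and undirected; multiple edges and loops are allowed, and isolated vertices are allowed. $V(G)$ is the vertex set of $G$ and $E(G)$ its (multi)set of edges; an edge with endpoints $u,v$ is written $uv$. Isomorphism of graphs means a bijection of vertex sets preserving the number of edges between each pair of (not necessarily distinct) vertices. For a positive integer $\ell$, $P(\ell)$ denotes the $\ell$-th prime number (so $P(1)=2$, $P(2)=3$, $P(4)=7$). For positive integers $i\ge j$ set $$a(i,j)=\frac{i(i+1)}{2}+(j-i).$$ For an integer $n\ge 1$, let $\widetilde{W}_n=(\widetilde{W}_n(i,j))_{1\le i,j\le n}$ be the symmetric $n\times n$ matrix with entries in $\mathbb{Z}[x]$ given, for $i\ge j$, by $$\widetilde{W}_n(i,j)=P\bigl(n^{\,n\,a(i,j)}\bigr)\,x^{P(n^{\,n\,a(i,j)})},$$ and $\widetilde{W}_n(j,i)=\widetilde{W}_n(i,j)$. For example, $$\widetilde{W}_2=\begin{pmatrix}7x^{7}&53x^{53}\\53x^{53}&311x^{311}\end{pmatrix}.$$ Let $X=\{1,2,\ldots,n\}$. A state function is any map $\sigma:V(G)\to X$. The pseudo $n$-state polynomial of $G$ is $$Z_{\widetilde{W}_n}(G)=\sum_{\sigma:V(G)\to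 X}\ \prod_{uv\in E(G)}\widetilde{W}_n(\sigma(u),\sigma(v))\in\mathbb{Z}[x],$$ where $\sigma$ runs over all state functions, the product is over all edges counted with multiplicity, and an empty product equals $1$. *)

theory Defs
  imports
    "HOL-Computational_Algebra.Computational_Algebra"
    "HOL-Library.Uprod"
    "HOL-Library.FuncSet"
    "HOL-Library.Infinite_Set"
begin

(* Edges are unordered pairs Upair u v; the loop at v is Upair v v.  Parallel edges are
   represented by multiplicity in the (automatically finite) multiset of edges. *)
record 'a multigraph =
  verts :: "'a set"
  edges :: "'a uprod multiset"

definition wf_multigraph :: "'a multigraph \<Rightarrow> bool" where
  "wf_multigraph G \<longleftrightarrow> finite (verts G) \<and> (\<forall>e\<in>#edges G. set_uprod e \<subseteq> verts G)"

definition isomorphic :: "'a multigraph \<Rightarrow> 'b multigraph \<Rightarrow> bool" where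
  "isomorphic G H \<longleftrightarrow> (\<exists>f. bij_betw f (verts G) (verts H) \<and>
     (\<forall>u\<in>verts G. \<forall>v\<in>verts G.
        count (edges G) (Upair u v) = count (edges H) (Upair (f u) (f v))))"

(* enumerate counts from 0, whereas P(1) = 2, so nth_prime is meant for arguments l >= 1. *)
definition nth_prime :: "nat \<Rightarrow> nat" where
  "nth_prime l = enumerate {p. prime p} (l - 1)"

(* i(i+1)/2 + (j - i), reordered so that for i, j >= 1 the truncated subtraction is exact. *)
definition tri_index :: "nat \<Rightarrow> nat \<Rightarrow> nat" where
  "tri_index i j = (i * (i + 1) div 2 + j) - i"

definition W_lower :: "nat \<Rightarrow> nat \<Rightarrow> nat \<Rightarrow> int poly" where
  "W_lower n i j =
     (let p = nth_prime (n ^ (n * tri_index i j)) in monom (int p) p)"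

(* The symmetric matrix with this lower triangle.  The type (nat, int poly) commute consists
   of the functions m with m i j = m j i, which can be evaluated at an unordered pair
   by case_uprod. *)
lift_definition W_tilde :: "nat \<Rightarrow> (nat, int poly) commute"
  is "\<lambda>n i j. if j \<le> i then W_lower n i j else W_lower n j i"
  by auto

(* State functions are taken extensional outside the vertex set, so that each map from
   verts G to {1..n} is counted exactly once. *)
definition state_polynomial :: "nat \<Rightarrow> (nat, int poly) commute \<Rightarrow> 'a multigraph \<Rightarrow> int poly" where
  "state_polynomial n M G =
     (\<Sum>\<sigma>\<in>verts G \<rightarrow>\<^sub>E {1..n}. \<Prod>e\<in>#edges G. case_uprod M (map_uprod \<sigma> e))"

definition Z_W_tilde :: "nat \<Rightarrow> 'a multigraph \<Rightarrow> int poly" where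
  "Z_W_tilde n G = state_polynomial n (W_tilde n) G"

end

theory Submission
  imports Defs
begin

text \<open>
  Take $n$ to be a large power of two. Chebyshev's lower bound for the number of primes up to
  $2^t$ gives $P(n^{na}) \le n^{n-1+na}$, whereas $P(n^{n(a+1)}) > n^{n(a+1)}$; hence consecutive
  primes occurring in $\widetilde W_n$ grow by a factor larger than $n$. For $n \ge |E(G)|$ the
  exponent of the monomial contributed by a state $\sigma$ therefore determines the multiset of
  colour pairs $\sigma(E(G))$, and the coefficients count the states with a given multiset.
  Counting all states, one recovers $|V(G)|$. An injective state on $G$ matches a state on $H$ with
  the same multiset of colour pairs; comparing the numbers of non-isolated vertices, it
  is injective on those of $H$, which yields an isomorphism.
\<close>

section \<open>Chebyshev's lower bound for the number of primes\<close>

text \<open>For D = lcm(1, ..., 2k) and the central binomial coefficient this makes D exponentially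
  large in k. The reciprocals of \<open>k * (n choose k)\<close> form Leibniz's harmonic triangle,
  whose recurrence drives the induction on k.\<close>

lemma times_binomial_dvd:
  fixes D :: nat
  assumes "\<And>i. 0 < i \<Longrightarrow> i \<le> N \<Longrightarrow> i dvd D" "0 < k" "k \<le> n" "n \<le> N"
  shows "k * (n choose k) dvd D"
  using assms(2-)
proof (induction k arbitrary: n)
  case 0
  then show ?case by simp
next
  case (Suc k)
  show ?case
  proof (cases "k = 0")
    case True
    then show ?thesis using assms(1)[of n] Suc.prems by simp
  next
    case False
    (* 1 / ((k + 1) C(n, k + 1)) = 1 / (k C(n - 1, k)) - 1 / (k C(n, k)), multiplied by D *)
    define a b c where "a = int (k * ((n - 1) choose k))" and "b = int (k * (n choose k))"
      and "c = int (Suc k * (n choose Suc k))"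
    define d where "d = int (k * ((n - 1) choose (k - 1)))"
    have "a dvd int D" "b dvd int D"
      unfolding a_def b_def int_dvd_int_iff using Suc.IH[of "n - 1"] Suc.IH[of n] Suc.prems False by auto
    then obtain x y where xy: "int D = a * x" "int D = b * y" by (auto elim!: dvdE)
    have bd: "b = a + d"
      unfolding a_def b_def d_def of_nat_add[symmetric] of_nat_eq_iff distrib_left[symmetric]
      using False Suc.prems choose_reduce_nat[of n k] by simp
    have c: "c = int (n * ((n - 1) choose k))"
      unfolding c_def using times_binomial_minus1_eq[of "Suc k" n] by simp
    have b: "b = int (n * ((n - 1) choose (k - 1)))"
      unfolding b_def using times_binomial_minus1_eq[of k n] False by simp
    have "c * d = a * b"
      unfolding c d_def a_def b by (simp add: algebra_simps)
    \<comment> \<open>Here d = b - a. Writing D = a x in b D and D = b y in a D leaves the common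
      factor a b = c d, so that d cancels.\<close>
    have "d * int D = d * (c * (x - y))"
      using xy bd \<open>c * d = a * b\<close> by algebra
    moreover have "d \<noteq> 0" unfolding d_def using False Suc.prems by auto
    ultimately have "int D = c * (x - y)" by simp
    then show ?thesis unfolding c_def by (metis dvd_triv_left int_dvd_int_iff)
  qed
qed

text \<open>The full power of a prime in the least common multiple already divides one of the
  numbers 1, ..., N, hence is at most N; and only primes up to N contribute.\<close>

lemma Lcm_le_power_card_primes:
  fixes N :: nat
  assumes "0 < N"
  shows "Lcm {1..N} \<le> N ^ card {p. prime p \<and> p \<le> N}"
proof -
  define D where "D = Lcm {1..N}"
  have D0: "D \<noteq> 0" unfolding D_def by simp
  have exponent: "\<exists>i\<in>{1..N}. p ^ multiplicity p D dvd i" if p: "prime p" for p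
  proof -
    \<comment> \<open>The induction over S carries along that the least common multiple is nonzero,
      which \<open>multiplicity_lcm\<close> requires.\<close>
    have "Lcm S \<noteq> 0 \<and> (\<exists>i\<in>S. p ^ multiplicity p (Lcm S) dvd i)"
      if "finite S" "S \<noteq> {}" "0 \<notin> S" for S :: "nat set"
      using that
    proof (induction S rule: finite_ne_induct)
      case (singleton x)
      then show ?case by (auto simp: multiplicity_dvd)
    next
      case (insert x F)
      then have *: "multiplicity p (lcm x (Lcm F)) = max (multiplicity p x) (multiplicity p (Lcm F))"
        using p by (intro multiplicity_lcm) auto
      show ?case
      proof (cases "multiplicity p (Lcm F) \<le> multiplicity p x")
        case True
        then show ?thesis using insert * by (auto simp: lcm_eq_0_iff max_def multiplicity_dvd)
      next
        case False
        then show ?thesis using insert * by (auto simp: lcm_eq_0_iff max_def)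
      qed
    qed
    from this[of "{1..N}"] show ?thesis using assms unfolding D_def by auto
  qed
  have le: "p ^ multiplicity p D \<le> N" if "prime p" for p
    using exponent[OF that] by (auto dest!: dvd_imp_le)
  have sub: "prime_factors D \<subseteq> {p. prime p \<and> p \<le> N}"
  proof
    fix p assume p: "p \<in> prime_factors D"
    then have "p \<le> p ^ multiplicity p D"
      by (intro self_le_power)
        (auto simp: prime_factors_multiplicity Suc_le_eq prime_gt_0_nat)
    also have "\<dots> \<le> N" using p by (intro le) auto
    finally show "p \<in> {p. prime p \<and> p \<le> N}" using p by auto
  qed
  have "D = (\<Prod>p\<in>prime_factors D. p ^ multiplicity p D)"
    using D0 by (simp add: prod_prime_factors)
  also have "\<dots> \<le> (\<Prod>p\<in>prime_factors D. N)"
    by (intro prod_mono) (use le in auto)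
  also have "\<dots> = N ^ card (prime_factors D)" by simp
  also have "\<dots> \<le> N ^ card {p. prime p \<and> p \<le> N}"
    using assms sub by (intro power_increasing card_mono) auto
  finally show ?thesis unfolding D_def .
qed

text \<open>For t > 1 and 2k = 2^t, compare exponents in 2^k <= k C(2k, k) <= lcm(1, ..., 2k) <=
  (2k)^pi(2k) = 2^(t pi(2k)). Powers of two keep the logarithm an exact natural number.\<close>

lemma card_primes_two_power_ge:
  assumes "0 < t"
  shows "2 ^ (t - 1) \<le> t * card {p::nat. prime p \<and> p \<le> 2 ^ t}"
proof (cases "t = 1")
  case True
  have "{p::nat. prime p \<and> p \<le> 2} = {2}" by (auto dest: prime_ge_2_nat)
  then show ?thesis using True by simp
next
  case False
  define k :: nat where "k = 2 ^ (t - 1)"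
  have k: "2 ^ t = 2 * k" "2 \<le> k"
  proof -
    show "2 ^ t = 2 * k" unfolding k_def using assms by (cases t) auto
    show "2 \<le> k" unfolding k_def using assms False by (intro self_le_power) auto
  qed
  let ?D = "Lcm {1..2 * k}"
  have D0: "0 < ?D" by (rule gr0I) simp
  have "4 ^ k / (2 * real k) \<le> real (2 * k choose k)"
    using central_binomial_lower_bound[of k] k by simp
  then have "(4::real) ^ k \<le> 2 * real (k * (2 * k choose k))"
    using k by (simp add: field_simps)
  then have "real (4 ^ k) \<le> real (2 * (k * (2 * k choose k)))" by simp
  then have "4 ^ k \<le> 2 * (k * (2 * k choose k))" by (simp only: of_nat_le_iff)
  moreover have "2 * (2::nat) ^ k \<le> 4 ^ k"
  proof -
    have "(2::nat) \<le> 2 ^ k" using k by (intro self_le_power) auto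
    then have "2 * (2::nat) ^ k \<le> 2 ^ k * 2 ^ k" by simp
    also have "\<dots> = 4 ^ k" by (simp flip: power_mult_distrib)
    finally show ?thesis .
  qed
  ultimately have "2 ^ k \<le> k * (2 * k choose k)" by simp
  also have "\<dots> \<le> ?D"
    by (rule dvd_imp_le[OF times_binomial_dvd[of "2 * k"] D0]) (use k in auto)
  also have "\<dots> \<le> (2 * k) ^ card {p. prime p \<and> p \<le> 2 * k}"
    using k by (intro Lcm_le_power_card_primes) auto
  also have "\<dots> = 2 ^ (t * card {p. prime p \<and> p \<le> 2 * k})"
    by (simp add: power_mult flip: k(1))
  finally show ?thesis using k by (simp add: k_def)
qed

section \<open>Growth of the primes in the matrix\<close>

lemma less_nth_prime: "l < nth_prime l"
proof -
  \<comment> \<open>Since \<open>enumerate\<close> starts at 0, the index k = l - 1 gives the bound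
    l + 1; for l = 0 truncation gives k = 0 and the bound 2.\<close>
  have "k + 2 \<le> enumerate {p::nat. prime p} k" for k
  proof (induction k)
    case 0
    show ?case using enumerate_in_set[OF primes_infinite, of 0] 
        prime_ge_2_nat[of "enumerate {p. prime p} 0"] by (simp del: enumerate_0)
  next
    case (Suc k)
    then show ?case using enumerate_step[OF primes_infinite, of k] by simp
  qed
  from this[of "l - 1"] show ?thesis unfolding nth_prime_def by simp
qed

text \<open>Were the l-th prime beyond x, all primes up to x would be among the first l - 1.\<close>

lemma nth_prime_le:
  assumes "l \<le> card {p. prime p \<and> p \<le> x}" "0 < l"
  shows "nth_prime l \<le> x"
proof (rule ccontr)
  let ?e = "enumerate {p::nat. prime p}"
  assume "\<not> nth_prime l \<le> x"
  then have x: "x < ?e (l - 1)" unfolding nth_prime_def by simp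
  have "{p. prime p \<and> p \<le> x} \<subseteq> ?e ` {..<l - 1}"
  proof
    fix p assume p: "p \<in> {p. prime p \<and> p \<le> x}"
    then obtain k where k: "?e k = p"
      using enumerate_Ex[OF primes_infinite, of p] by auto
    with p x have "?e k < ?e (l - 1)" by simp
    then have "k < l - 1" using primes_infinite by simp
    with k show "p \<in> ?e ` {..<l - 1}" by auto
  qed
  from card_mono[OF _ this] have "card {p. prime p \<and> p \<le> x} \<le> l - 1"
    using card_image_le[of "{..<l - 1}" ?e] by simp
  with assms show False by simp
qed

lemma nth_prime_gap:
  assumes n: "n = 2 ^ r" and r: "3 \<le> r" and a: "a < b" "a < n\<^sup>2"
  shows "n * nth_prime (n ^ (n * a)) < nth_prime (n ^ (n * b))"
proof -
  \<comment> \<open>Chosen so that 2^t = n^(n - 1 + n a), one factor n short of n^(n (a + 1)); n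
    being a power of two makes t an integer.\<close>
  define t where "t = r * (n - 1 + n * a)"
  have rn: "r \<le> n" unfolding n by (simp add: less_imp_le)
  have "(2::nat) ^ 3 \<le> 2 ^ r" using r by (intro power_increasing) auto
  then have n8: "8 \<le> n" using n by simp
  have X: "2 ^ t = n ^ (n - 1) * n ^ (n * a)"
    unfolding t_def power_mult power_add n[symmetric] by (simp add: power_mult)
  have tpos: "0 < t" using r n8 unfolding t_def by simp
  \<comment> \<open>Chebyshev's bound loses a factor 2t, crudely at most n^5. As 3 <= r gives n >=
    8, the slack n^(n - 1) absorbs it.\<close>
  have "2 * t \<le> 2 * (n * (n + n * a))" unfolding t_def using rn by (intro mult_le_mono) auto
  also have "\<dots> = 2 * n\<^sup>2 * (a + 1)" by (simp add: power2_eq_square algebra_simps)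
  also have "\<dots> \<le> n * n\<^sup>2 * n\<^sup>2" using a n8 by (intro mult_le_mono) auto
  also have "\<dots> = n ^ 5" by (simp add: eval_nat_numeral)
  also have "\<dots> \<le> n ^ (n - 1)" using n8 by (intro power_increasing) auto
  finally have t: "2 * t \<le> n ^ (n - 1)" .
  have "2 * t * n ^ (n * a) \<le> 2 ^ t" unfolding X using t by (intro mult_le_mono) auto
  also have "2 ^ t = 2 * (2::nat) ^ (t - 1)" using tpos by (cases t) auto
  also have "\<dots> \<le> 2 * (t * card {p::nat. prime p \<and> p \<le> 2 ^ t})"
    using card_primes_two_power_ge[OF tpos] by simp
  finally have "n ^ (n * a) \<le> card {p::nat. prime p \<and> p \<le> 2 ^ t}" using tpos by simp
  then have "nth_prime (n ^ (n * a)) \<le> 2 ^ t" using n8 by (intro nth_prime_le) auto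
  then have "n * nth_prime (n ^ (n * a)) \<le> n * n ^ (n - 1) * n ^ (n * a)" by (simp add: X)
  also have "\<dots> = n ^ (n * (a + 1))"
    using n8 by (cases n) (simp_all add: power_add algebra_simps)
  also have "\<dots> \<le> n ^ (n * b)" using a n8 by (intro power_increasing mult_le_mono) auto
  also have "\<dots> < nth_prime (n ^ (n * b))" by (rule less_nth_prime)
  finally show ?thesis .
qed

section \<open>Recovering a multiset from its sum\<close>

text \<open>At most m elements bounded by x sum to at most m x, which is below every larger element
  of S. Equal sums therefore have equal maxima, which are removed by induction. The value 0 is
  excluded because it could be added without changing the sum.\<close>

lemma sum_mset_inject_sparse:
  fixes A B :: "nat multiset"
  assumes gap: "\<And>x y. x \<in> S \<Longrightarrow> y \<in> S \<Longrightarrow> x < y \<Longrightarrow> m * x < y" and "0 \<notin> S"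
    and "set_mset A \<subseteq> S" "set_mset B \<subseteq> S" "size A \<le> m" "size B \<le> m"
    and "sum_mset A = sum_mset B"
  shows "A = B"
  using assms(3-)
proof (induction "size A" arbitrary: A B)
  case 0
  then have "sum_mset B = 0" by simp
  then have "\<forall>x\<in>#B. x = 0" by (simp add: sum_mset_0_iff)
  moreover have "\<forall>x\<in>#B. x \<noteq> 0" using 0(3) \<open>0 \<notin> S\<close> by (metis subset_eq)
  ultimately show ?case using 0 by (cases B) auto
next
  case (Suc k)
  have ub: "sum_mset C \<le> m * Max_mset C" if "size C \<le> m" for C
  proof -
    have "sum_mset C = (\<Sum>x\<in>#C. x)" by simp
    also have "\<dots> \<le> (\<Sum>x\<in>#C. Max_mset C)" by (intro sum_mset_mono) auto
    also have "\<dots> \<le> m * Max_mset C" using that by simp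
    finally show ?thesis .
  qed
  have ge: "x \<le> sum_mset C" if "x \<in># C" for x :: nat and C
    using that by (auto dest!: multi_member_split)
  have "A \<noteq> {#}" using Suc(2) by auto
  then have xA: "Max_mset A \<in># A" by (intro Max_in) auto
  have "Max_mset A \<noteq> 0" using xA Suc.prems(1) \<open>0 \<notin> S\<close> by (metis subset_eq)
  then have "sum_mset B \<noteq> 0" using ge[OF xA] Suc.prems(5) by linarith
  then have "B \<noteq> {#}" by auto
  then have xB: "Max_mset B \<in># B" by (intro Max_in) auto
  have S: "Max_mset A \<in> S" "Max_mset B \<in> S" using xA xB Suc.prems by auto
  have "\<not> Max_mset A < Max_mset B"
    using gap[of "Max_mset A" "Max_mset B"] S ub[of A] ge[OF xB] Suc.prems by linarith
  moreover have "\<not> Max_mset B < Max_mset A"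
    using gap[of "Max_mset B" "Max_mset A"] S ub[of B] ge[OF xA] Suc.prems by linarith
  ultimately obtain x where x: "x \<in># A" "x \<in># B" using xA xB by (metis linorder_neqE_nat)
  then obtain A' B' where AB: "A = add_mset x A'" "B = add_mset x B'"
    by (metis multi_member_split)
  have "A' = B'" by (rule Suc(1)) (use Suc AB in auto)
  then show ?case using AB by simp
qed

section \<open>Indexing of the lower triangle\<close>

text \<open>With T(i) = i(i + 1)/2, row i fills the block from T(i - 1) + 1 to T(i), so the rows
  occupy consecutive disjoint blocks.\<close>

lemma tri_index_less:
  assumes "i < i'" "1 \<le> j" "j \<le> i" "1 \<le> j'"
  shows "tri_index i j < tri_index i' j'"
proof -
  obtain k where k: "i' = Suc k" "i \<le> k" using assms by (cases i') auto
  then have "i * (i + 1) \<le> k * (k + 1)" by (intro mult_le_mono) auto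
  then have "i * (i + 1) + i' * 2 \<le> i' * (i' + 1)" using k by simp
  from div_le_mono[OF this, of 2] have "i * (i + 1) div 2 + i' \<le> i' * (i' + 1) div 2"
    by (simp only: div_mult_self1 zero_neq_numeral[symmetric] not_False_eq_True)
  moreover have "0 < j" "0 < j'" "j \<le> i" using assms by auto
  ultimately show ?thesis unfolding tri_index_def by linarith
qed

lemma tri_index_inject:
  assumes "tri_index i j = tri_index i' j'" "1 \<le> j" "j \<le> i" "1 \<le> j'" "j' \<le> i'"
  shows "i = i' \<and> j = j'"
proof -
  have "i = i'" using assms tri_index_less[of i i' j j'] tri_index_less[of i' i j' j]
    by (metis less_irrefl linorder_neqE_nat)
  \<comment> \<open>This makes the truncated subtraction of i exact, so that j can be cancelled
    out.\<close>
  moreover have "i \<le> i * (i + 1) div 2" using assms div_le_mono[of "i * 2" "i * (i + 1)" 2] by simp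
  ultimately show ?thesis using assms(1) unfolding tri_index_def by simp
qed

lemma tri_index_less_square:
  assumes "j \<le> i" "i \<le> n" "2 \<le> n"
  shows "tri_index i j < n\<^sup>2"
proof -
  have "i * (i + 1) \<le> n * (n + 1)" using assms by (intro mult_le_mono) auto
  also have "\<dots> < 2 * n\<^sup>2" using assms by (simp add: power2_eq_square)
  finally show ?thesis using assms unfolding tri_index_def by linarith
qed

section \<open>Multisets of matrix entries\<close>

text \<open>An entry has the form p x^p, so its degree is the prime p. Reading p off the degree
  gives a function on unordered pairs without choosing an order.\<close>

definition W_prime :: "nat \<Rightarrow> nat uprod \<Rightarrow> nat" where
  "W_prime n q = degree (case_uprod (W_tilde n) q)"

lemma degree_monom_int: "degree (monom (int p) p) = p"
  \<comment> \<open>For p = 0 the monomial is the zero polynomial, whose degree is 0 by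
    convention.\<close>
  by (cases "p = 0") (auto simp: degree_monom_eq)

lemma W_prime_Upair:
  assumes "j \<le> i"
  shows "W_prime n (Upair i j) = nth_prime (n ^ (n * tri_index i j))"
  using assms by (simp add: W_prime_def W_tilde.rep_eq W_lower_def Let_def degree_monom_int)

lemma W_tilde_eq_monom:
  "case_uprod (W_tilde n) q = monom (int (W_prime n q)) (W_prime n q)"
  by (cases q) (simp add: W_prime_def W_tilde.rep_eq W_lower_def Let_def degree_monom_int)

lemma uprod_ordered_cases:
  assumes "set_uprod q \<subseteq> {1..n::nat}"
  obtains i j where "q = Upair i j" "1 \<le> j" "j \<le> i" "i \<le> n"
proof (cases q)
  case (Upair x y)
  then show ?thesis
    using assms that[of x y] that[of y x] by (cases "y \<le> x") auto
qed

text \<open>Distinct pairs of colours have distinct indices below n^2, so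
  \<open>nth_prime_gap\<close> applies in one order or the other.\<close>

lemma W_prime_gap:
  assumes n: "n = 2 ^ r" "3 \<le> r" and "set_uprod q \<subseteq> {1..n}" "set_uprod q' \<subseteq> {1..n}" "q \<noteq> q'"
  shows "n * W_prime n q < W_prime n q' \<or> n * W_prime n q' < W_prime n q"
proof -
  have "(2::nat) ^ 3 \<le> 2 ^ r" using n by (intro power_increasing) auto
  then have n2: "2 \<le> n" using n by simp
  obtain i j where q: "q = Upair i j" "1 \<le> j" "j \<le> i" "i \<le> n"
    using assms uprod_ordered_cases by metis
  obtain i' j' where q': "q' = Upair i' j'" "1 \<le> j'" "j' \<le> i'" "i' \<le> n"
    using assms uprod_ordered_cases by metis
  have "tri_index i j \<noteq> tri_index i' j'"
    using tri_index_inject[of i j i' j'] q q' assms(5) by auto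
  moreover have "tri_index i j < n\<^sup>2" "tri_index i' j' < n\<^sup>2"
    using tri_index_less_square q q' n2 by auto
  ultimately show ?thesis
    using nth_prime_gap[OF n, of "tri_index i j" "tri_index i' j'"]
      nth_prime_gap[OF n, of "tri_index i' j'" "tri_index i j"] q q'
    by (auto simp: W_prime_Upair neq_iff)
qed

lemma W_prime_pos:
  assumes "set_uprod q \<subseteq> {1..n}"
  shows "0 < W_prime n q"
  using assms less_nth_prime by (metis W_prime_Upair gr_zeroI not_less_zero uprod_ordered_cases)

text \<open>The sum is the degree of a state's monomial. \<open>sum_mset_inject_sparse\<close>
  recovers the multiset of primes from it, and injectivity of \<open>W_prime n\<close> on colour
  pairs recovers the pairs.\<close>

lemma sum_W_prime_inject:
  assumes n: "n = 2 ^ r" "3 \<le> r"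
    and A: "\<forall>q\<in>#A. set_uprod q \<subseteq> {1..n}" and B: "\<forall>q\<in>#B. set_uprod q \<subseteq> {1..n}"
    and "size A \<le> n" "size B \<le> n"
    and eq: "(\<Sum>q\<in>#A. W_prime n q) = (\<Sum>q\<in>#B. W_prime n q)"
  shows "A = B"
proof -
  let ?Q = "{q. set_uprod q \<subseteq> {1..n}}"
  have gap: "n * W_prime n q < W_prime n q'"
    if "q \<in> ?Q" "q' \<in> ?Q" "W_prime n q < W_prime n q'" for q q'
  proof -
    \<comment> \<open>This rules out the reversed alternative of \<open>W_prime_gap\<close>.\<close>
    have "W_prime n q \<le> n * W_prime n q'"
      using that n by (metis less_imp_le mult_le_mono1 nat_mult_1 one_le_numeral one_le_power order_trans)
    then show ?thesis using W_prime_gap[OF n, of q q'] that by auto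
  qed
  have inj: "inj_on (W_prime n) ?Q"
  proof (rule inj_onI, rule ccontr)
    fix q q' assume "q \<in> ?Q" "q' \<in> ?Q" "W_prime n q = W_prime n q'" "q \<noteq> q'"
    then have "n * W_prime n q < W_prime n q" using W_prime_gap[OF n, of q q'] by auto
    moreover have "1 * W_prime n q \<le> n * W_prime n q" unfolding n(1) by (intro mult_le_mono1) simp
    ultimately show False by linarith
  qed
  have pos: "0 \<notin> W_prime n ` ?Q"
    using W_prime_pos by (metis (no_types, lifting) imageE less_irrefl mem_Collect_eq)
  have "image_mset (W_prime n) A = image_mset (W_prime n) B"
    by (rule sum_mset_inject_sparse[of "W_prime n ` ?Q" n])
      (use assms gap pos in auto)
  moreover have "image_mset (inv_into ?Q (W_prime n)) (image_mset (W_prime n) C) = C"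
    if "\<forall>q\<in>#C. q \<in> ?Q" for C
    unfolding multiset.map_comp
    using that inj by (intro multiset.map_ident_strong) simp
  ultimately show ?thesis using A B by (metis mem_Collect_eq)
qed

section \<open>Coefficients of the state polynomial\<close>

abbreviation colouring_image :: "'a multigraph \<Rightarrow> ('a \<Rightarrow> nat) \<Rightarrow> nat uprod multiset" where
  "colouring_image G \<sigma> \<equiv> image_mset (map_uprod \<sigma>) (edges G)"

text \<open>All information taken from the polynomial: the graph is later reconstructed from these
  numbers alone.\<close>

definition fibre_count :: "nat \<Rightarrow> 'a multigraph \<Rightarrow> nat uprod multiset \<Rightarrow> nat" where
  "fibre_count n G \<mu> = card {\<sigma> \<in> verts G \<rightarrow>\<^sub>E {1..n}. colouring_image G \<sigma> = \<mu>}"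

lemma prod_mset_monom:
  "(\<Prod>e\<in>#E. monom (int (w e)) (w e)) =
     monom (int (\<Prod>e\<in>#E. w e)) (\<Sum>e\<in>#E. w e)"
  by (induction E) (auto simp: mult_monom one_pCons monom_0)

lemma Z_W_tilde_eq_sum_monom:
  "Z_W_tilde n G =
     (\<Sum>\<sigma>\<in>verts G \<rightarrow>\<^sub>E {1..n}.
        monom (int (\<Prod>q\<in>#colouring_image G \<sigma>. W_prime n q))
          (\<Sum>q\<in>#colouring_image G \<sigma>. W_prime n q))"
  unfolding Z_W_tilde_def state_polynomial_def
  by (simp add: W_tilde_eq_monom prod_mset_monom image_mset.compositionality comp_def)

lemma set_colouring_image:
  assumes "wf_multigraph G" "\<sigma> \<in> verts G \<rightarrow>\<^sub>E C" "q \<in># colouring_image G \<sigma>"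
  shows "set_uprod q \<subseteq> C"
  using assms unfolding wf_multigraph_def by (fastforce simp: uprod.set_map PiE_def)

text \<open>A state reaches this degree only if its multiset of colour pairs is
  \<open>\<mu>\<close>, and all such states contribute the same product of primes.\<close>

lemma coeff_Z_W_tilde:
  assumes G: "wf_multigraph G" and n: "n = 2 ^ r" "3 \<le> r" and "size (edges G) \<le> n"
    and \<mu>: "\<forall>q\<in>#\<mu>. set_uprod q \<subseteq> {1..n}" "size \<mu> \<le> n"
  shows "coeff (Z_W_tilde n G) (\<Sum>q\<in>#\<mu>. W_prime n q) =
    int (\<Prod>q\<in>#\<mu>. W_prime n q) * int (fibre_count n G \<mu>)"
proof -
  have fin: "finite (verts G \<rightarrow>\<^sub>E {1..n})"
    using G unfolding wf_multigraph_def by (intro finite_PiE) auto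
  have "coeff (Z_W_tilde n G) (\<Sum>q\<in>#\<mu>. W_prime n q) =
    (\<Sum>\<sigma>\<in>verts G \<rightarrow>\<^sub>E {1..n}.
      if colouring_image G \<sigma> = \<mu> then int (\<Prod>q\<in>#\<mu>. W_prime n q) else 0)"
    unfolding Z_W_tilde_eq_sum_monom coeff_sum
  proof (rule sum.cong[OF refl])
    fix \<sigma> assume \<sigma>: "\<sigma> \<in> verts G \<rightarrow>\<^sub>E {1..n}"
    have "colouring_image G \<sigma> = \<mu>"
      if "(\<Sum>q\<in>#colouring_image G \<sigma>. W_prime n q) = (\<Sum>q\<in>#\<mu>. W_prime n q)"
      by (rule sum_W_prime_inject[OF n _ \<mu>(1) _ \<mu>(2) that])
        (use set_colouring_image[OF G \<sigma>] assms(4) in auto)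
    then show "coeff (monom (int (\<Prod>q\<in>#colouring_image G \<sigma>. W_prime n q))
          (\<Sum>q\<in>#colouring_image G \<sigma>. W_prime n q)) (\<Sum>q\<in>#\<mu>. W_prime n q) =
        (if colouring_image G \<sigma> = \<mu> then int (\<Prod>q\<in>#\<mu>. W_prime n q) else 0)"
      by (auto simp only: coeff_monom split: if_splits)
  qed
  also have "\<dots> = int (\<Prod>q\<in>#\<mu>. W_prime n q) *
      int (fibre_count n G \<mu>)"
    using fin unfolding fibre_count_def by (simp flip: sum.inter_filter)
  finally show ?thesis .
qed

text \<open>Covers the multisets outside the scope of \<open>coeff_Z_W_tilde\<close>, so that fibres
  can be compared for every \<open>\<mu>\<close>.\<close>

lemma fibre_count_eq_0:
  assumes "wf_multigraph G" "size (edges G) \<le> n"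
    and "\<not> ((\<forall>q\<in>#\<mu>. set_uprod q \<subseteq> {1..n}) \<and> size \<mu> \<le> n)"
  shows "fibre_count n G \<mu> = 0"
proof -
  have "colouring_image G \<sigma> \<noteq> \<mu>" if \<sigma>: "\<sigma> \<in> verts G \<rightarrow>\<^sub>E {1..n}" for \<sigma>
  proof
    assume \<mu>: "colouring_image G \<sigma> = \<mu>"
    have "\<forall>q\<in>#\<mu>. set_uprod q \<subseteq> {1..n}"
      using set_colouring_image[OF assms(1) \<sigma>] \<mu> by blast
    moreover have "size \<mu> \<le> n" using assms(2) \<mu> by auto
    ultimately show False using assms(3) by blast
  qed
  then have "{\<sigma> \<in> verts G \<rightarrow>\<^sub>E {1..n}. colouring_image G \<sigma> = \<mu>} = {}" by blast
  then show ?thesis unfolding fibre_count_def by (simp only: card.empty)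
qed

lemma fibre_count_eq:
  assumes "wf_multigraph G" "wf_multigraph H" and n: "n = 2 ^ r" "3 \<le> r"
    and "size (edges G) \<le> n" "size (edges H) \<le> n" and Z: "Z_W_tilde n G = Z_W_tilde n H"
  shows "fibre_count n G \<mu> = fibre_count n H \<mu>"
proof (cases "(\<forall>q\<in>#\<mu>. set_uprod q \<subseteq> {1..n}) \<and> size \<mu> \<le> n")
  case True
  let ?c = "int (\<Prod>q\<in>#\<mu>. W_prime n q)"
  have "?c * int (fibre_count n G \<mu>) = ?c * int (fibre_count n H \<mu>)"
    using coeff_Z_W_tilde[of G n r \<mu>] coeff_Z_W_tilde[of H n r \<mu>] assms True by metis
  \<comment> \<open>The common factor is a product of positive numbers and can be cancelled.\<close>
  moreover have "\<forall>q\<in>#\<mu>. W_prime n q \<noteq> 0" using True W_prime_pos[of _ n] by (auto simp only: less_irrefl)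
  then have "?c \<noteq> 0" by (auto simp: prod_mset_zero_iff)
  ultimately show ?thesis by (simp only: mult_cancel_left of_nat_eq_iff simp_thms)
next
  case False
  then show ?thesis using fibre_count_eq_0 assms by metis
qed

section \<open>Edge multiplicities under injective maps\<close>

text \<open>The element x need not occur in A; this covers pairs of vertices that are not joined by
  an edge.\<close>

lemma count_image_mset_inj_on:
  assumes "inj_on f (insert x (set_mset A))"
  shows "count (image_mset f A) (f x) = count A x"
  using assms
proof (induction A)
  case (add y A)
  then have "inj_on f (insert x (set_mset A))" by (auto simp: inj_on_def)
  with add show ?case by (auto simp: inj_on_def)
qed auto

lemma inj_on_map_uprod:
  assumes "inj_on f S"
  shows "inj_on (map_uprod f) {q. set_uprod q \<subseteq> S}"
proof (rule inj_onI)
  fix p q assume "p \<in> {q. set_uprod q \<subseteq> S}" "q \<in> {q. set_uprod q \<subseteq> S}" "map_uprod f p = map_uprod f q"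
  then show "p = q"
    using assms by (cases p; cases q) (auto dest: inj_onD)
qed

lemma count_map_uprod:
  assumes "inj_on f S" "\<forall>e\<in>#E. set_uprod e \<subseteq> S" "u \<in> S" "v \<in> S"
  shows "count (image_mset (map_uprod f) E) (Upair (f u) (f v)) = count E (Upair u v)"
  using count_image_mset_inj_on[of "map_uprod f" "Upair u v" E]
    inj_on_subset[OF inj_on_map_uprod[OF assms(1)], of "insert (Upair u v) (set_mset E)"] assms(2-)
  by auto

section \<open>Reconstruction of the graph\<close>

text \<open>The non-isolated vertices; a vertex whose only edge is a loop is included.\<close>

definition touched :: "'a multigraph \<Rightarrow> 'a set" where
  "touched G = (\<Union>e\<in>set_mset (edges G). set_uprod e)"

lemma touched_subset_verts: "wf_multigraph G \<Longrightarrow> touched G \<subseteq> verts G"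
  unfolding wf_multigraph_def touched_def by auto

text \<open>States with the same multiset of colour pairs use the same colours on non-isolated
  vertices, even when they live on different graphs.\<close>

lemma image_touched: "\<sigma> ` touched G = (\<Union>q\<in>set_mset (colouring_image G \<sigma>). set_uprod q)"
  unfolding touched_def by (auto simp: uprod.set_map image_UN)

lemma count_edges_untouched:
  assumes "u \<notin> touched G \<or> v \<notin> touched G"
  shows "count (edges G) (Upair u v) = 0"
  using assms unfolding touched_def by (auto simp: not_in_iff[symmetric])

text \<open>With n >= |V(G)| colours G has an injective state, so its fibre is nonempty, and so is
  the corresponding fibre of H. Nothing is claimed yet about injectivity of
  \<open>\<tau>\<close>.\<close>

lemma injective_colouring_transfer:
  assumes G: "wf_multigraph G" and H: "wf_multigraph H"
    and fibres: "\<And>\<mu>. fibre_count n G \<mu> = fibre_count n H \<mu>" and n: "card (verts G) \<le> n"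
  obtains \<sigma> \<tau> where "inj_on \<sigma> (verts G)" "colouring_image G \<sigma> = colouring_image H \<tau>"
proof -
  have fin: "finite (verts G)" "finite (verts H)" using G H unfolding wf_multigraph_def by auto
  obtain \<sigma>0 where "\<sigma>0 ` verts G \<subseteq> {1..n}" "inj_on \<sigma>0 (verts G)"
    using card_le_inj[of "verts G" "{1..n}"] fin n by auto
  then have \<sigma>: "restrict \<sigma>0 (verts G) \<in> verts G \<rightarrow>\<^sub>E {1..n}" "inj_on (restrict \<sigma>0 (verts G)) (verts G)"
    by auto
  let ?\<mu> = "colouring_image G (restrict \<sigma>0 (verts G))"
  \<comment> \<open>An infinite set would also have cardinality 0, so finiteness is needed to get a
    nonzero count.\<close>
  have "finite {\<sigma> \<in> verts G \<rightarrow>\<^sub>E {1..n}. colouring_image G \<sigma> = ?\<mu>}"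
    using fin by (intro finite_subset[OF _ finite_PiE[of "verts G" "\<lambda>_. {1..n}"]]) auto
  then have "fibre_count n G ?\<mu> \<noteq> 0"
    using \<sigma>(1) unfolding fibre_count_def card_eq_0_iff by blast
  then have "fibre_count n H ?\<mu> \<noteq> 0" using fibres by simp
  then obtain \<tau> where "colouring_image H \<tau> = ?\<mu>"
    unfolding fibre_count_def by (auto simp: card_eq_0_iff)
  with \<sigma> that show ?thesis by metis
qed

text \<open>All colours of an injective state on the non-isolated vertices of G reappear on those of
  H. Exchanging G and H later gives equality.\<close>

lemma card_touched_le:
  assumes G: "wf_multigraph G" and H: "wf_multigraph H"
    and "\<And>\<mu>. fibre_count n G \<mu> = fibre_count n H \<mu>" "card (verts G) \<le> n"
  shows "card (touched G) \<le> card (touched H)"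
proof -
  obtain \<sigma> \<tau> where st: "inj_on \<sigma> (verts G)" "colouring_image G \<sigma> = colouring_image H \<tau>"
    using injective_colouring_transfer[OF assms] .
  have "card (touched G) = card (\<sigma> ` touched G)"
    using st touched_subset_verts[OF G] by (metis card_image inj_on_subset)
  also have "\<sigma> ` touched G = \<tau> ` touched H" using st by (simp only: image_touched)
  also have "card \<dots> \<le> card (touched H)"
    unfolding touched_def by (intro card_image_le) auto
  finally show ?thesis .
qed

text \<open>The fibres partition the set of all states. M may be larger than the set of attained
  multisets, so that one M serves two graphs.\<close>

lemma sum_fibre_count:
  assumes "wf_multigraph G" "finite M" "colouring_image G ` (verts G \<rightarrow>\<^sub>E {1..n}) \<subseteq> M"
  shows "(\<Sum>\<mu>\<in>M. fibre_count n G \<mu>) = n ^ card (verts G)"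
proof -
  have fin: "finite (verts G)" using assms unfolding wf_multigraph_def by simp
  have "(\<Sum>\<mu>\<in>M. fibre_count n G \<mu>) = (\<Sum>\<sigma>\<in>verts G \<rightarrow>\<^sub>E {1..n}. 1)"
    unfolding fibre_count_def card_eq_sum
    using assms fin by (intro sum.group) (auto intro!: finite_PiE)
  then show ?thesis using fin by (simp add: card_funcsetE)
qed

text \<open>Isolated vertices leave no trace in the colour pairs; they are detected by the total
  number n^|V| of states, whose exponent is determined as n >= 2.\<close>

lemma card_verts_eq:
  assumes "wf_multigraph G" "wf_multigraph H"
    and "\<And>\<mu>. fibre_count n G \<mu> = fibre_count n H \<mu>" "2 \<le> n"
  shows "card (verts G) = card (verts H)"
proof -
  let ?M = "colouring_image G ` (verts G \<rightarrow>\<^sub>E {1..n}) \<union> colouring_image H ` (verts H \<rightarrow>\<^sub>E {1..n})"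
  have "finite ?M" using assms unfolding wf_multigraph_def by (auto intro!: finite_PiE)
  then have "n ^ card (verts G) = n ^ card (verts H)"
    using sum_fibre_count[of G ?M n] sum_fibre_count[of H ?M n] assms by auto
  then show ?thesis using assms by simp
qed

lemma isomorphic_if_fibre_count_eq:
  assumes G: "wf_multigraph G" and H: "wf_multigraph H"
    and fibres: "\<And>\<mu>. fibre_count n G \<mu> = fibre_count n H \<mu>"
    and n: "2 \<le> n" "card (verts G) \<le> n"
  shows "isomorphic G H"
proof -
  have fin: "finite (verts G)" "finite (verts H)" using G H unfolding wf_multigraph_def by auto
  have tG: "touched G \<subseteq> verts G" and tH: "touched H \<subseteq> verts H"
    using touched_subset_verts G H by auto
  have finT: "finite (touched G)" "finite (touched H)" using fin tG tH finite_subset by auto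
  have V: "card (verts G) = card (verts H)" using card_verts_eq[OF G H fibres] n by simp
  have T: "card (touched G) = card (touched H)"
    using card_touched_le[OF G H fibres] card_touched_le[OF H G fibres[symmetric]] n V by simp
  obtain \<sigma> \<tau> where st: "inj_on \<sigma> (verts G)" "colouring_image G \<sigma> = colouring_image H \<tau>"
    using injective_colouring_transfer[OF G H fibres n(2)] .
  have im: "\<sigma> ` touched G = \<tau> ` touched H" using st by (simp only: image_touched)
  have inj\<sigma>: "inj_on \<sigma> (touched G)" using st tG inj_on_subset by blast
  \<comment> \<open>\<open>\<tau>\<close> maps \<open>touched H\<close> onto a set of the same
    finite size, hence injectively.\<close>
  have inj\<tau>: "inj_on \<tau> (touched H)"
    using finT T im inj\<sigma> by (metis card_image eq_card_imp_inj_on)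
  \<comment> \<open>Each non-isolated vertex of G goes to the vertex of H with the same
    colour.\<close>
  define g where "g = inv_into (touched H) \<tau> \<circ> \<sigma>"
  have g: "bij_betw g (touched G) (touched H)"
    unfolding g_def using inj\<sigma> inj\<tau> im
    by (metis bij_betw_imageI bij_betw_inv_into bij_betw_trans)
  have \<tau>g: "\<tau> (g u) = \<sigma> u" if "u \<in> touched G" for u
    using that im unfolding g_def by (auto intro!: f_inv_into_f)
  \<comment> \<open>Isolated vertices are equally many on both sides, and any bijection between them
    will do.\<close>
  have "card (verts G - touched G) = card (verts H - touched H)"
    using V T tG tH finT by (simp add: card_Diff_subset)
  then obtain h where h: "bij_betw h (verts G - touched G) (verts H - touched H)"
    using fin finite_same_card_bij by blast
  define f where "f u = (if u \<in> touched G then g u else h u)" for u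
  have fg: "bij_betw f (touched G) (touched H)"
    using g by (rule bij_betw_cong[THEN iffD1, rotated]) (auto simp: f_def)
  have fh: "bij_betw f (verts G - touched G) (verts H - touched H)"
    using h by (rule bij_betw_cong[THEN iffD1, rotated]) (auto simp: f_def)
  have "bij_betw f (touched G \<union> (verts G - touched G)) (touched H \<union> (verts H - touched H))"
    using fg fh by (rule bij_betw_combine) auto
  then have "bij_betw f (verts G) (verts H)" using tG tH by (simp add: Un_absorb1)
  moreover have "count (edges G) (Upair u v) = count (edges H) (Upair (f u) (f v))"
    if uv: "u \<in> verts G" "v \<in> verts G" for u v
  proof (cases "u \<in> touched G \<and> v \<in> touched G")
    case True
    have gH: "g u \<in> touched H" "g v \<in> touched H" using g True bij_betwE by blast+
    have "count (edges G) (Upair u v) = count (colouring_image G \<sigma>) (Upair (\<sigma> u) (\<sigma> v))"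
      by (rule count_map_uprod[OF inj\<sigma>, symmetric]) (use True in \<open>auto simp: touched_def\<close>)
    also have "\<dots> = count (colouring_image H \<tau>) (Upair (\<tau> (g u)) (\<tau> (g v)))"
      using st True \<tau>g by simp
    also have "\<dots> = count (edges H) (Upair (g u) (g v))"
      by (rule count_map_uprod[OF inj\<tau>]) (use gH in \<open>auto simp: touched_def\<close>)
    finally show ?thesis using True by (simp add: f_def)
  next
    case False
    \<comment> \<open>\<open>f\<close> sends isolated vertices to isolated ones, so both
      multiplicities are 0.\<close>
    then have "f u \<notin> touched H \<or> f v \<notin> touched H"
      using fh uv bij_betwE by blast
    then show ?thesis using False count_edges_untouched by metis
  qed
  ultimately show ?thesis unfolding isomorphic_def by blast
qed

section \<open>Invariance under isomorphism\<close>

text \<open>This form allows products over edges to be rewritten. Pairs not inside the vertex set of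
  H have multiplicity 0 on both sides by well-formedness.\<close>

lemma edges_isomorphic:
  assumes G: "wf_multigraph G" and H: "wf_multigraph H" and f: "bij_betw f (verts G) (verts H)"
    and count: "\<forall>u\<in>verts G. \<forall>v\<in>verts G.
        count (edges G) (Upair u v) = count (edges H) (Upair (f u) (f v))"
  shows "edges H = image_mset (map_uprod f) (edges G)"
proof (rule multiset_eqI)
  fix q
  show "count (edges H) q = count (image_mset (map_uprod f) (edges G)) q"
  proof (cases "set_uprod q \<subseteq> verts H")
    case True
    obtain x y where q: "q = Upair x y" by (cases q)
    with True f obtain u v where uv: "u \<in> verts G" "v \<in> verts G" "x = f u" "y = f v"
      unfolding bij_betw_def by (metis imageE insert_subset set_uprod_simps)
    have "count (image_mset (map_uprod f) (edges G)) (Upair (f u) (f v)) = count (edges G) (Upair u v)"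
      by (rule count_map_uprod[of f "verts G"]) (use f G uv in \<open>auto simp: bij_betw_def wf_multigraph_def\<close>)
    then show ?thesis using count uv q by simp
  next
    case False
    then have "q \<notin># edges H" using H unfolding wf_multigraph_def by auto
    moreover have "q \<notin># image_mset (map_uprod f) (edges G)"
      using False f G unfolding wf_multigraph_def bij_betw_def by (fastforce simp: uprod.set_map)
    ultimately show ?thesis by (simp only: not_in_iff)
  qed
qed

text \<open>Composition with the isomorphism is a bijection between the states of H and those of G
  that preserves each product, whatever the symmetric matrix.\<close>

lemma state_polynomial_isomorphic:
  assumes G: "wf_multigraph G" and H: "wf_multigraph H" and "isomorphic G H"
  shows "state_polynomial n M G = state_polynomial n M H"
proof -
  obtain f where f: "bij_betw f (verts G) (verts H)"
    and E: "edges H = image_mset (map_uprod f) (edges G)"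
    using assms edges_isomorphic unfolding isomorphic_def by blast
  \<comment> \<open>States are extensional, so the composite has to be restricted to the vertex
    set.\<close>
  let ?r = "\<lambda>\<tau>. restrict (\<tau> \<circ> f) (verts G)" and ?g = "inv_into (verts G) f"
  have g: "bij_betw ?g (verts H) (verts G)" using f by (rule bij_betw_inv_into)
  have fH: "f v \<in> verts H" "?g (f v) = v" if "v \<in> verts G" for v
    using f that by (auto simp: bij_betw_def)
  have gG: "?g v \<in> verts G" "f (?g v) = v" if "v \<in> verts H" for v
    using f g that by (auto simp: bij_betw_def f_inv_into_f)
  have "state_polynomial n M H =
      (\<Sum>\<tau>\<in>verts H \<rightarrow>\<^sub>E {1..n}. \<Prod>e\<in>#edges G. case_uprod M (map_uprod (?r \<tau>) e))"
    unfolding state_polynomial_def E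
  proof (rule sum.cong[OF refl])
    fix \<tau>
    have "case_uprod M (map_uprod \<tau> (map_uprod f e)) = case_uprod M (map_uprod (?r \<tau>) e)"
      if "e \<in># edges G" for e
    proof -
      have "map_uprod \<tau> (map_uprod f e) = map_uprod (?r \<tau>) e"
        unfolding uprod.map_comp
        using that G by (intro uprod.map_cong0) (auto simp: wf_multigraph_def)
      then show ?thesis by simp
    qed
    then show "(\<Prod>e\<in>#image_mset (map_uprod f) (edges G). case_uprod M (map_uprod \<tau> e)) =
        (\<Prod>e\<in>#edges G. case_uprod M (map_uprod (?r \<tau>) e))"
      by (simp add: image_mset.compositionality comp_def cong: image_mset_cong)
  qed
  also have "\<dots> = state_polynomial n M G"
    unfolding state_polynomial_def
  proof (rule sum.reindex_bij_witness[where i = "\<lambda>\<sigma>. restrict (\<sigma> \<circ> ?g) (verts H)" and j = ?r])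
    fix \<tau> assume \<tau>: "\<tau> \<in> verts H \<rightarrow>\<^sub>E {1..n}"
    show "restrict (?r \<tau> \<circ> ?g) (verts H) = \<tau>"
      using \<tau> gG by (auto simp: fun_eq_iff restrict_def PiE_def extensional_def)
    show "?r \<tau> \<in> verts G \<rightarrow>\<^sub>E {1..n}" using \<tau> fH by auto
  next
    fix \<sigma> assume \<sigma>: "\<sigma> \<in> verts G \<rightarrow>\<^sub>E {1..n}"
    show "?r (restrict (\<sigma> \<circ> ?g) (verts H)) = \<sigma>"
      using \<sigma> fH by (auto simp: fun_eq_iff restrict_def PiE_def extensional_def)
    show "restrict (\<sigma> \<circ> ?g) (verts H) \<in> verts H \<rightarrow>\<^sub>E {1..n}" using \<sigma> gG by auto
  qed auto
  finally show ?thesis ..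
qed

theorem theorem1p2:
  fixes G :: "'a multigraph" and H :: "'b multigraph"
  assumes "wf_multigraph G" and "wf_multigraph H"
  shows "(\<forall>n\<ge>1. Z_W_tilde n G = Z_W_tilde n H) \<longleftrightarrow> isomorphic G H"
proof
  assume Z: "\<forall>n\<ge>1. Z_W_tilde n G = Z_W_tilde n H"
  \<comment> \<open>A single n suffices: 2^r > r bounds the edge numbers of both graphs and |V(G)|,
    and the summand 3 meets the hypothesis of the gap estimate.\<close>
  define r where "r = 3 + size (edges G) + size (edges H) + card (verts G)"
  define n :: nat where "n = 2 ^ r"
  have "r < n" unfolding n_def by simp
  then have n: "size (edges G) \<le> n" "size (edges H) \<le> n" "card (verts G) \<le> n" "2 \<le> n"
    unfolding r_def by auto
  have "3 \<le> r" unfolding r_def by simp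
  have "fibre_count n G \<mu> = fibre_count n H \<mu>" for \<mu>
    using fibre_count_eq[OF assms n_def \<open>3 \<le> r\<close> n(1,2)] Z n(4) by simp
  then show "isomorphic G H"
    using isomorphic_if_fibre_count_eq[OF assms _ n(4,3)] by blast
next
  assume "isomorphic G H"
  then show "\<forall>n\<ge>1. Z_W_tilde n G = Z_W_tilde n H"
    unfolding Z_W_tilde_def using state_polynomial_isomorphic assms by blast
qed

end
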